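(* Suppose trader $t$ submits evidence set $E'_t\subseteq E_t$ and holds true belief $q_t$ (under exogenous resolution) or $q_t(E'_t)$ (under endogenous resolution). Then under the evidence-augmented LMSR it is optimal for the trader to submit $q_t$ or $q_t(E'_t)$ as their belief report, in the respective case. That is, with the evidence submission $E'_t$ fixed and $q$ denoting the respective true belief, the report $\hat q_t=q$ maximizes the expected payoff $\mathbb{E}_{\omega\sim q}\big[\mathrm{payoff}_t(\hat q_t,E'_t)\big]$ over all reports $\hat q_t\in\Delta(n-1)$. Further, the platform loss is bounded by $\beta(R_0)\log n=:\beta_0\log n$.
   Context: An event has $n$ possible outcomes, and $\Delta(n-1)$ is the $(n-1)$-dimensional probability simplex over them; $q^\omega$ is the probability that a vector $q$ assigns to outcome $\omega$. Traders arrive sequentially. Trader $t$ holds an evidence set $E_t$ and submits a subset $E'_t\subseteq E_t$ together with a belief report $\hat q_t\in\Delta(n-1)$, which may differ from their true belief. Evidence quality is measured by a function $r$ on evidence sets with $r(E)\ge 0$ and $r(E_1)\le r(E_2)$ whenever $E_1\subseteq E_2$. $E^{total}_t$ is the total evidence in the market at time $t$, so $E^{total}_t=E^{total}_{t-1}\cup E'_t$, and $R_t=r(E^{total}_t)$; $R_0$ is the initial quality. The liquidity parameter is a positive function $\beta(\cdot)$ of the cumulative evidence quality. $q_{t-1}$ denotes the belief submitted by the trader immediately before $t$, and $q_0$ the initial market belief. Evidence-augmented LMSR (logarithmic market scoring rule): when the resolution outcome is $\omega$, the payoff of trader $t$ is $$\mathrm{payoff}_t(\hat q_t,E'_t)=\beta\big(r(E^{total}_{t-1}\cup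 E'_t)\big)\log \hat q_t^{\,\omega}-\beta\big(r(E^{total}_{t-1})\big)\log q_{t-1}^{\,\omega}=\beta(R_t)\log \hat q_t^{\,\omega}-\beta(R_{t-1})\log q_{t-1}^{\,\omega}.$$ The platform loss is the cumulative amount paid out by the platform, i.e. the sum of all traders' payoffs. Exogenous resolution: the outcome is determined externally, and trader $t$'s true belief $q_t\in\Delta(n-1)$ is unaffected by the evidence they submit. Endogenous resolution: the market resolves once $K$ pieces of evidence have accumulated. Each piece $e$ has a binary outcome $X_{ie}\in\{0,1\}$ for each alternative $i$ ($1$ if $e$ supports $i$, $0$ if it refutes $i$). With $\theta_i$ the fraction of the $K$ pieces supporting $i$, the resolved outcome is sampled from the softmax of $(\theta_1,\dots,\theta_n)$ with temperature $\tau$, i.e. with probabilities proportional to $\exp(\theta_i/\tau)$. Trader $t$'s true belief about resolution when submitting $E'_t$ is the vector $q_t(E'_t)$ (also written $q(E'_t)$) with entries $$q_{tj}(E'_t)=\mathbb{E}\left[\frac{\exp(\theta_{tj}(E'_t)/\tau)}{\sum_{\ell}\exp(\theta_{t\ell}(E'_t)/\tau)}\right],\qquad \theta_{tj}(E'_t)=\frac{k_j(t)+|E'_{t,j}|+S_j}{K},$$ where $k_j(t)$ is the number of pieces already in the market that support $j$, $E'_{t,j}$ is the part of $E'_t$ supporting $j$, $S_j$ is the random number of supports for $j$ among the remaining future pieces of evidence (there are $K-k(t)-|E'_t|$ of these, $k(t)$ being the number of pieces already collected), and the expectation is over $(S_1,\dots,S_n)$.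
   Formalization: The loss bound is stated for a uniform initial belief q_0 (it fails for any other q_0) and for resolved outcomes to which every trader before the last gave positive probability (otherwise the sum of payoffs is undefined); log 0 is read as −∞. *)

theory Defs
  imports "HOL-Probability.Probability"
begin

definition prob_simplex :: "(real ^ 'n) set" where
  "prob_simplex = {q. (\<forall>i. 0 \<le> q $ i) \<and> (\<Sum>i\<in>UNIV. q $ i) = 1}"

definition uniform_belief :: "real ^ 'n" where
  "uniform_belief = (\<chi> i. 1 / real CARD('n))"

(* Reports on the boundary of the simplex are allowed, so the logarithm must take
   the value -\<infinity> at 0; the library's real ln 0 = 0 would reward such reports. *)
definition eln :: "real \<Rightarrow> ereal" where
  "eln x = (if 0 < x then ereal (ln x) else - \<infinity>)"

primrec total_evidence :: "'e set \<Rightarrow> (nat \<Rightarrow> 'e set) \<Rightarrow> nat \<Rightarrow> 'e set" where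
  "total_evidence E0 E' 0 = E0"
| "total_evidence E0 E' (Suc t) = total_evidence E0 E' t \<union> E' (Suc t)"

(* A is the total evidence before the trader arrives, E' the trader's submission,
   p the preceding belief in the market and qhat the trader's report. *)
definition lmsr_payoff ::
    "(real \<Rightarrow> real) \<Rightarrow> ('e set \<Rightarrow> real) \<Rightarrow> 'e set \<Rightarrow> real ^ 'n \<Rightarrow> 'e set \<Rightarrow> real ^ 'n \<Rightarrow> 'n \<Rightarrow> ereal"
  where
  "lmsr_payoff \<beta> r A p E' qhat \<omega> =
     ereal (\<beta> (r (A \<union> E'))) * eln (qhat $ \<omega>) - ereal (\<beta> (r A)) * eln (p $ \<omega>)"

(* In ereal, 0 * (-\<infinity>) = 0 * \<infinity> = 0, so outcomes of probability 0 do not contribute. *)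
definition expected_payoff ::
    "(real \<Rightarrow> real) \<Rightarrow> ('e set \<Rightarrow> real) \<Rightarrow> 'e set \<Rightarrow> real ^ 'n \<Rightarrow> 'e set \<Rightarrow> real ^ 'n \<Rightarrow> real ^ 'n \<Rightarrow> ereal"
  where
  "expected_payoff \<beta> r A p E' q qhat =
     (\<Sum>\<omega>\<in>UNIV. ereal (q $ \<omega>) * lmsr_payoff \<beta> r A p E' qhat \<omega>)"

(* qhat 0 is the initial market belief and qhat t the report of trader t. *)
definition platform_loss ::
    "(real \<Rightarrow> real) \<Rightarrow> ('e set \<Rightarrow> real) \<Rightarrow> 'e set \<Rightarrow> (nat \<Rightarrow> 'e set) \<Rightarrow> (nat \<Rightarrow> real ^ 'n) \<Rightarrow> nat \<Rightarrow> 'n \<Rightarrow> ereal"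
  where
  "platform_loss \<beta> r E0 E' qhat T \<omega> =
     (\<Sum>t = 1..T. lmsr_payoff \<beta> r (total_evidence E0 E' (t - 1)) (qhat (t - 1)) (E' t) (qhat t) \<omega>)"

definition softmax :: "real \<Rightarrow> real ^ 'n \<Rightarrow> real ^ 'n" where
  "softmax \<tau> \<theta> = (\<chi> j. exp (\<theta> $ j / \<tau>) / (\<Sum>l\<in>UNIV. exp (\<theta> $ l / \<tau>)))"

(* X j e: piece e supports alternative j.  Y j i w: in scenario w, the i-th future piece
   supports j.  The last summand is the random number S_j of future supports for j. *)
definition support_fraction ::
    "nat \<Rightarrow> ('n \<Rightarrow> 'e \<Rightarrow> bool) \<Rightarrow> ('n \<Rightarrow> nat \<Rightarrow> 'w \<Rightarrow> bool) \<Rightarrow> 'e set \<Rightarrow> 'e set \<Rightarrow> 'w \<Rightarrow> real ^ 'n"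
  where
  "support_fraction K X Y A E' w =
     (\<chi> j. (real (card {e \<in> A. X j e}) + real (card {e \<in> E'. X j e})
             + real (card {i. i < K - card A - card E' \<and> Y j i w})) / real K)"

definition endogenous_belief ::
    "'w measure \<Rightarrow> real \<Rightarrow> nat \<Rightarrow> ('n \<Rightarrow> 'e \<Rightarrow> bool) \<Rightarrow> ('n \<Rightarrow> nat \<Rightarrow> 'w \<Rightarrow> bool)
      \<Rightarrow> 'e set \<Rightarrow> 'e set \<Rightarrow> real ^ 'n"
  where
  "endogenous_belief M \<tau> K X Y A E' =
     (\<chi> j. \<integral>w. softmax \<tau> (support_fraction K X Y A E' w) $ j \<partial>M)"

end

theory Submission
  imports Defs
begin

text \<open>Properness of the rule is Gibbs' inequality, scaled by the weight \<open>\<beta> (R\<^sub>t)\<close>, which does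
  not depend on the report; the subtracted term does not depend on the report either. The
  payoffs telescope, the last logarithm is nonpositive, and the initial one is \<open>- ln n\<close>.\<close>

text \<open>The inequality holds term by term: \<open>ln x \<le> x - 1\<close> at
  \<open>x = p i / q i\<close>, multiplied by \<open>q i\<close>, bounds the difference by
  \<open>p i - q i\<close>, and these sum to at most 0. The support condition matters because
  \<open>ln 0 = 0\<close>: without it, a \<open>p\<close> vanishing where \<open>q\<close> does not
  would be rewarded.\<close>

lemma Gibbs_inequality:
  fixes p q :: "'a \<Rightarrow> real"
  assumes "finite A"
    and p: "\<And>i. i \<in> A \<Longrightarrow> 0 \<le> p i" and q: "\<And>i. i \<in> A \<Longrightarrow> 0 \<le> q i"
    and supp: "\<And>i. i \<in> A \<Longrightarrow> 0 < q i \<Longrightarrow> 0 < p i"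
    and le: "sum p A \<le> sum q A"
  shows "(\<Sum>i\<in>A. q i * ln (p i)) \<le> (\<Sum>i\<in>A. q i * ln (q i))"
proof -
  have "q i * ln (p i) - q i * ln (q i) \<le> p i - q i" if "i \<in> A" for i
  proof (cases "q i = 0")
    case True
    then show ?thesis using p[OF that] by simp
  next
    case False
    then have pos: "0 < q i" "0 < p i" using q[OF that] supp[OF that] by auto
    then have "ln (p i) - ln (q i) \<le> p i / q i - 1"
      using ln_le_minus_one[of "p i / q i"] by (simp add: ln_div)
    from mult_left_mono[OF this, of "q i"] pos show ?thesis
      by (simp add: algebra_simps)
  qed
  then have "(\<Sum>i\<in>A. q i * ln (p i) - q i * ln (q i)) \<le> (\<Sum>i\<in>A. p i - q i)"
    by (rule sum_mono)
  with le show ?thesis by (simp add: sum_subtractf)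
qed

lemma lmsr_payoff_finite:
  assumes "0 < qhat $ \<omega>" "0 < p $ \<omega>"
  shows "lmsr_payoff \<beta> r A p E' qhat \<omega> =
    ereal (\<beta> (r (A \<union> E')) * ln (qhat $ \<omega>) - \<beta> (r A) * ln (p $ \<omega>))"
  using assms by (simp add: lmsr_payoff_def eln_def)

text \<open>The subtracted term is -\<infinity> here. In \<open>ereal\<close>, \<infinity> absorbs
  every summand, even -\<infinity>, so the value is the same when the report vanishes at
  \<open>\<omega>\<close> too.\<close>

lemma lmsr_payoff_PInf:
  assumes "0 < \<beta> (r A)" "\<not> 0 < p $ \<omega>"
  shows "lmsr_payoff \<beta> r A p E' qhat \<omega> = \<infinity>"
  using assms by (simp add: lmsr_payoff_def eln_def)

lemma lmsr_payoff_MInf: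
  assumes "0 < \<beta> (r (A \<union> E'))" "\<not> 0 < qhat $ \<omega>" "0 < p $ \<omega>"
  shows "lmsr_payoff \<beta> r A p E' qhat \<omega> = - \<infinity>"
  using assms by (simp add: lmsr_payoff_def eln_def)

text \<open>Positivity is required only on the support of \<open>q\<close>: off it the payoff may be
  infinite, but the factor 0 removes it.\<close>

lemma expected_payoff_finite:
  assumes q: "\<And>\<omega>. 0 \<le> q $ \<omega>"
    and pos: "\<And>\<omega>. 0 < q $ \<omega> \<Longrightarrow> 0 < qhat $ \<omega> \<and> 0 < p $ \<omega>"
  shows "expected_payoff \<beta> r A p E' q qhat =
    ereal (\<beta> (r (A \<union> E')) * (\<Sum>\<omega>\<in>UNIV. q $ \<omega> * ln (qhat $ \<omega>))
           - \<beta> (r A) * (\<Sum>\<omega>\<in>UNIV. q $ \<omega> * ln (p $ \<omega>)))"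
proof -
  have "ereal (q $ \<omega>) * lmsr_payoff \<beta> r A p E' qhat \<omega> =
     ereal (\<beta> (r (A \<union> E')) * (q $ \<omega> * ln (qhat $ \<omega>)) - \<beta> (r A) * (q $ \<omega> * ln (p $ \<omega>)))" for \<omega>
  proof (cases "q $ \<omega> = 0")
    case False
    then have "0 < q $ \<omega>" using q[of \<omega>] by simp
    then show ?thesis
      using pos[of \<omega>] by (simp add: lmsr_payoff_finite algebra_simps)
  qed (simp flip: zero_ereal_def)
  then show ?thesis
    by (simp add: expected_payoff_def sum_subtractf sum_distrib_left)
qed

lemma expected_payoff_PInf:
  assumes "0 < \<beta> (r A)" "0 < q $ \<omega>" "\<not> 0 < p $ \<omega>"
  shows "expected_payoff \<beta> r A p E' q qhat = \<infinity>"
  unfolding expected_payoff_def sum_Pinfty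
  using assms by (auto simp: lmsr_payoff_PInf intro!: bexI[of _ \<omega>])

text \<open>A single -\<infinity> term decides the sum only if no term is \<infinity>, since
  \<infinity> would win. The condition on \<open>p\<close> rules such terms out.\<close>

lemma expected_payoff_MInf:
  assumes "0 < \<beta> (r (A \<union> E'))"
    and q: "\<And>\<omega>. 0 \<le> q $ \<omega>"
    and p: "\<And>\<omega>. 0 < q $ \<omega> \<Longrightarrow> 0 < p $ \<omega>"
    and \<omega>: "0 < q $ \<omega>" "\<not> 0 < qhat $ \<omega>"
  shows "expected_payoff \<beta> r A p E' q qhat = - \<infinity>"
proof -
  let ?f = "\<lambda>\<omega>. ereal (q $ \<omega>) * lmsr_payoff \<beta> r A p E' qhat \<omega>"
  have "?f i \<noteq> \<infinity>" for i
  proof (cases "q $ i = 0")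
    case False
    then have "0 < q $ i" using q[of i] by simp
    then show ?thesis
      using assms(1) p[of i] by (cases "0 < qhat $ i") (simp_all add: lmsr_payoff_finite lmsr_payoff_MInf)
  qed simp
  then have "sum ?f (UNIV - {\<omega>}) \<noteq> \<infinity>"
    by (auto simp: sum_Pinfty)
  moreover have "?f \<omega> = - \<infinity>"
    using assms(1) \<omega> p[of \<omega>] by (simp add: lmsr_payoff_MInf)
  ultimately show ?thesis
    unfolding expected_payoff_def by (subst sum.remove[of _ \<omega>]) auto
qed

text \<open>Gibbs' inequality covers only finite expectations, so zeros on the support of
  \<open>q\<close> are split off first. If \<open>p\<close> has one, every report earns \<infinity>
  and all reports tie. If only the report \<open>y\<close> has one, it earns -\<infinity>. The
  truthful report \<open>q\<close> never vanishes on its own support.\<close>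

lemma lmsr_proper:
  assumes \<beta>: "0 < \<beta> (r A)" "0 < \<beta> (r (A \<union> E'))"
    and q: "q \<in> prob_simplex"
  shows "is_arg_max (expected_payoff \<beta> r A p E' q) (\<lambda>y. y \<in> prob_simplex) q"
proof -
  have q0: "\<And>\<omega>. 0 \<le> q $ \<omega>"
    using q by (simp add: prob_simplex_def)
  have "expected_payoff \<beta> r A p E' q y \<le> expected_payoff \<beta> r A p E' q q"
    if y: "y \<in> prob_simplex" for y
  proof (cases "\<exists>\<omega>. 0 < q $ \<omega> \<and> \<not> 0 < p $ \<omega>")
    case True
    then show ?thesis using \<beta>(1) by (auto simp: expected_payoff_PInf)
  next
    case False
    then have p: "\<And>\<omega>. 0 < q $ \<omega> \<Longrightarrow> 0 < p $ \<omega>" by blast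
    show ?thesis
    proof (cases "\<exists>\<omega>. 0 < q $ \<omega> \<and> \<not> 0 < y $ \<omega>")
      case True
      then show ?thesis using expected_payoff_MInf[of \<beta> r A E' q p _ y, OF \<beta>(2) q0 p] by force
    next
      case False
      then have "(\<Sum>\<omega>\<in>UNIV. q $ \<omega> * ln (y $ \<omega>)) \<le> (\<Sum>\<omega>\<in>UNIV. q $ \<omega> * ln (q $ \<omega>))"
        using q y by (intro Gibbs_inequality) (auto simp: prob_simplex_def)
      with \<beta>(2) False p q0 show ?thesis
        by (simp add: expected_payoff_finite)
    qed
  qed
  then show ?thesis
    using q by (auto simp: is_arg_max_def not_less)
qed

lemma sum_exp_pos: "0 < (\<Sum>l\<in>(UNIV :: 'n::finite set). exp (f l :: real))"
  by (rule sum_pos) auto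

lemma softmax_in_simplex: "softmax \<tau> \<theta> \<in> prob_simplex"
  using sum_exp_pos[of "\<lambda>l. \<theta> $ l / \<tau>"]
  by (auto simp: prob_simplex_def softmax_def sum_nonneg simp flip: sum_divide_distrib)

lemma prob_simplex_le_1: "q \<in> prob_simplex \<Longrightarrow> q $ i \<le> 1"
  using member_le_sum[of i UNIV "($) q"] by (simp add: prob_simplex_def)

lemma support_fraction_measurable:
  assumes [measurable]: "\<And>j i. Measurable.pred M (Y j i)"
  shows "(\<lambda>w. support_fraction K X Y A E' w $ j) \<in> borel_measurable M"
proof -
  \<comment> \<open>Written as a finite sum of indicators, the random count is measurable because
    each \<open>Y j i\<close> is.\<close>
  have "real (card {i. i < n \<and> Y j i w}) = (\<Sum>i<n. if Y j i w then 1 else 0)" for n w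
    by (simp add: sum.If_cases lessThan_def Collect_conj_eq)
  then show ?thesis
    by (simp add: support_fraction_def)
qed

lemma softmax_measurable:
  assumes [measurable]: "\<And>j. (\<lambda>w. \<theta> w $ j) \<in> borel_measurable M"
  shows "(\<lambda>w. softmax \<tau> (\<theta> w) $ j) \<in> borel_measurable M"
  by (simp add: softmax_def)

text \<open>The belief is an average of softmax vectors, each in the simplex, and the simplex is
  preserved by expectation.\<close>

lemma endogenous_belief_in_simplex:
  assumes "prob_space M" "\<And>j i. Measurable.pred M (Y j i)"
  shows "endogenous_belief M \<tau> K X Y A E' \<in> prob_simplex"
proof -
  interpret prob_space M by fact
  let ?s = "\<lambda>j w. softmax \<tau> (support_fraction K X Y A E' w) $ j"
  have s: "0 \<le> ?s j w" "?s j w \<le> 1" "(\<Sum>j\<in>UNIV. ?s j w) = 1" for j w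
    using softmax_in_simplex[of \<tau> "support_fraction K X Y A E' w"]
    by (auto simp: prob_simplex_def prob_simplex_le_1)
  \<comment> \<open>Exchanging the integral with the finite sum needs integrability; boundedness by
    1 on a probability space gives it.\<close>
  have "integrable M (?s j)" for j
    using assms(2) s
    by (intro integrable_const_bound[where B = 1] softmax_measurable support_fraction_measurable) auto
  then have "(\<Sum>j\<in>UNIV. \<integral>w. ?s j w \<partial>M) = (\<integral>w. (\<Sum>j\<in>UNIV. ?s j w) \<partial>M)"
    by simp
  also have "\<dots> = 1"
    using s(3) by (simp add: prob_space)
  finally show ?thesis
    using s(1) by (simp add: endogenous_belief_def prob_simplex_def)
qed

text \<open>Each intermediate report enters two consecutive payoffs with opposite signs and the same
  weight. These terms cancel only if the logarithm is finite, hence the positivity conditions. The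
  last report has no partner; it may vanish at \<open>\<omega>\<close> and therefore stays under
  \<open>eln\<close>.\<close>

lemma platform_loss_telescope:
  assumes "0 < qhat 0 $ \<omega>" "\<And>t. t \<in> {1..<T} \<Longrightarrow> 0 < qhat t $ \<omega>"
  shows "platform_loss \<beta> r E0 E' qhat T \<omega> =
    ereal (\<beta> (r (total_evidence E0 E' T))) * eln (qhat T $ \<omega>)
      - ereal (\<beta> (r E0) * ln (qhat 0 $ \<omega>))"
  using assms(2)
proof (induction T)
  case 0
  then show ?case using assms(1) by (simp add: platform_loss_def eln_def)
next
  case (Suc T)
  \<comment> \<open>In the step to \<open>Suc T\<close> the report \<open>qhat T\<close> becomes
    intermediate; for \<open>T = 0\<close> it is the initial belief. Its \<open>eln\<close> in the
    induction hypothesis is thus a real logarithm.\<close>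
  have pos: "0 < qhat T $ \<omega>" using assms(1) Suc.prems by (cases "T = 0") auto
  have "platform_loss \<beta> r E0 E' qhat (Suc T) \<omega> = platform_loss \<beta> r E0 E' qhat T \<omega>
     + lmsr_payoff \<beta> r (total_evidence E0 E' T) (qhat T) (E' (Suc T)) (qhat (Suc T)) \<omega>"
    by (simp add: platform_loss_def)
  also have "platform_loss \<beta> r E0 E' qhat T \<omega> =
     ereal (\<beta> (r (total_evidence E0 E' T)) * ln (qhat T $ \<omega>) - \<beta> (r E0) * ln (qhat 0 $ \<omega>))"
    using Suc pos by (simp add: eln_def)
  \<comment> \<open>The real terms at \<open>T\<close> cancel; the case split is there because the
    new last term need not be finite.\<close>
  finally show ?case
    using pos by (cases "ereal (\<beta> (r (total_evidence E0 E' (Suc T)))) * eln (qhat (Suc T) $ \<omega>)")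
      (simp_all add: lmsr_payoff_def eln_def)
qed

lemma eln_nonpos: "x \<le> 1 \<Longrightarrow> eln x \<le> 0"
  by (simp add: eln_def)

text \<open>A final report that vanishes at \<open>\<omega>\<close> can only lower the loss. An
  intermediate one could not be allowed: under positive liquidity the next trader would be paid
  \<infinity> by \<open>lmsr_payoff_PInf\<close>.\<close>

lemma platform_loss_bound:
  fixes qhat :: "nat \<Rightarrow> real ^ 'n"
  assumes "0 \<le> \<beta> (r (total_evidence E0 E' T))" "qhat T \<in> prob_simplex"
    and "qhat 0 = uniform_belief" "\<And>t. t \<in> {1..<T} \<Longrightarrow> 0 < qhat t $ \<omega>"
  shows "platform_loss \<beta> r E0 E' qhat T \<omega> \<le> ereal (\<beta> (r E0) * ln (real CARD('n)))"
proof -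
  have u: "qhat 0 $ \<omega> = 1 / real CARD('n)"
    using assms(3) by (simp add: uniform_belief_def)
  have "ereal (\<beta> (r (total_evidence E0 E' T))) * eln (qhat T $ \<omega>) \<le> 0"
    using assms(1,2) by (simp add: ereal_mult_le_0_iff eln_nonpos prob_simplex_le_1)
  then have "ereal (\<beta> (r (total_evidence E0 E' T))) * eln (qhat T $ \<omega>)
      - ereal (\<beta> (r E0) * ln (qhat 0 $ \<omega>)) \<le> 0 - ereal (\<beta> (r E0) * ln (qhat 0 $ \<omega>))"
    by (rule ereal_minus_mono) simp
  then show ?thesis
    using assms(4) by (subst platform_loss_telescope) (simp_all add: u ln_div)
qed

theorem proposition1:
  fixes r :: "'e set \<Rightarrow> real"
    and \<beta> :: "real \<Rightarrow> real"
    and E0 :: "'e set"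
    and E E' :: "nat \<Rightarrow> 'e set"
    and qhat :: "nat \<Rightarrow> real ^ 'n"
    and T :: nat
    and M :: "'w measure"
    and \<tau> :: real
    and K :: nat
    and X :: "'n \<Rightarrow> 'e \<Rightarrow> bool"
    and Y :: "'n \<Rightarrow> nat \<Rightarrow> 'w \<Rightarrow> bool"
  assumes quality_nonneg: "\<And>A. 0 \<le> r A"
    and quality_mono: "\<And>A B. A \<subseteq> B \<Longrightarrow> r A \<le> r B"
    and liquidity_pos: "\<And>x. 0 \<le> x \<Longrightarrow> 0 < \<beta> x"
    and submissions: "\<And>t. t \<in> {1..T} \<Longrightarrow> E' t \<subseteq> E t"
    and beliefs: "\<And>t. t \<le> T \<Longrightarrow> qhat t \<in> prob_simplex"
  shows
    "(\<forall>t\<in>{1..T}. \<forall>q\<in>prob_simplex.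
        is_arg_max
          (expected_payoff \<beta> r (total_evidence E0 E' (t - 1)) (qhat (t - 1)) (E' t) q)
          (\<lambda>p. p \<in> prob_simplex) q)
   \<and> (\<forall>t\<in>{1..T}.
        prob_space M \<and> (\<forall>j i. Measurable.pred M (Y j i)) \<and> 0 < \<tau> \<and> 0 < K
        \<and> finite (total_evidence E0 E' (t - 1)) \<and> finite (E' t)
        \<and> card (total_evidence E0 E' (t - 1)) + card (E' t) \<le> K \<longrightarrow>
        (let q = endogenous_belief M \<tau> K X Y (total_evidence E0 E' (t - 1)) (E' t) in
          is_arg_max
            (expected_payoff \<beta> r (total_evidence E0 E' (t - 1)) (qhat (t - 1)) (E' t) q)
            (\<lambda>p. p \<in> prob_simplex) q))
   \<and> (qhat 0 = uniform_belief \<longrightarrow>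
        (\<forall>\<omega>. (\<forall>t\<in>{1..<T}. 0 < qhat t $ \<omega>) \<longrightarrow>
          platform_loss \<beta> r E0 E' qhat T \<omega> \<le> ereal (\<beta> (r E0) * ln (real CARD('n)))))"
proof -
  \<comment> \<open>Liquidity is positive only at nonnegative arguments, which evidence qualities
    are.\<close>
  have \<beta>: "0 < \<beta> (r A)" for A
    by (intro liquidity_pos quality_nonneg)
  show ?thesis
    unfolding Let_def
  proof (intro conjI ballI impI allI)
    fix t and q :: "real ^ 'n" assume "q \<in> prob_simplex"
    then show "is_arg_max
        (expected_payoff \<beta> r (total_evidence E0 E' (t - 1)) (qhat (t - 1)) (E' t) q)
        (\<lambda>p. p \<in> prob_simplex) q"
      by (intro lmsr_proper \<beta>)
  next
    fix t assume "prob_space M \<and> (\<forall>j i. Measurable.pred M (Y j i)) \<and> 0 < \<tau> \<and> 0 < K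
        \<and> finite (total_evidence E0 E' (t - 1)) \<and> finite (E' t)
        \<and> card (total_evidence E0 E' (t - 1)) + card (E' t) \<le> K"
    \<comment> \<open>With the submission fixed, the endogenous belief is one fixed point of the
      simplex, independent of the report, so the argument of the exogenous case applies to
      it.\<close>
    then show "is_arg_max
        (expected_payoff \<beta> r (total_evidence E0 E' (t - 1)) (qhat (t - 1)) (E' t)
          (endogenous_belief M \<tau> K X Y (total_evidence E0 E' (t - 1)) (E' t)))
        (\<lambda>p. p \<in> prob_simplex)
        (endogenous_belief M \<tau> K X Y (total_evidence E0 E' (t - 1)) (E' t))"
      by (intro lmsr_proper \<beta> endogenous_belief_in_simplex) blast+
  next
    fix \<omega> assume "qhat 0 = uniform_belief" "\<forall>t\<in>{1..<T}. 0 < qhat t $ \<omega>"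
    then show "platform_loss \<beta> r E0 E' qhat T \<omega> \<le> ereal (\<beta> (r E0) * ln (real CARD('n)))"
      by (intro platform_loss_bound less_imp_le[OF \<beta>] beliefs) auto
  qed
qed

end
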